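(* If $q\in\mathcal{CS}$, then $\tfrac qn\in\mathcal{CS}$ for every $n\in\mathbb Z\setminus\{0\}$.
   Context: For $q\in\mathbb Q$ let $\Gamma_q\le \mathrm{SL}(2,\mathbb R)$ be the subgroup generated by $\begin{pmatrix}1&1\\0&1\end{pmatrix}$ and $\begin{pmatrix}1&0\\ q&1\end{pmatrix}$. For coprime integers $s,t$ with $t\neq0$, $\Gamma_1^{(t)}(s)$ is the group of matrices $\begin{pmatrix}a&b\\c&d\end{pmatrix}\in \mathrm{SL}(2,\mathbb Z[\tfrac1t])$ with $a-1,\ d-1,\ c\in s\mathbb Z[\tfrac1t]$. The set $\mathcal{CS}$ is the set of all $q\in\mathbb Q\cap(-4,4)$ such that, writing $q=\tfrac st$ in lowest terms, $\Gamma_q=\Gamma_1^{(t)}(s)$. *)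

theory Defs
  imports "HOL-Analysis.Analysis" "HOL-Algebra.Generated_Groups"
begin

definition mat2 :: "real \<Rightarrow> real \<Rightarrow> real \<Rightarrow> real \<Rightarrow> real^2^2" where
  "mat2 a b c d = vector [vector [a, b], vector [c, d]]"

definition SL2R :: "(real^2^2) monoid" where
  "SL2R = \<lparr>carrier = {A. det A = 1}, mult = (**), one = mat 1\<rparr>"

lemma group_SL2R: "group SL2R"
proof (rule groupI)
  fix A assume "A \<in> carrier SL2R"
  then have A: "det A = 1" by (simp add: SL2R_def)
  then have "invertible A" by (simp add: invertible_det_nz)
  then obtain B where B: "B ** A = mat 1" by (auto simp: invertible_def)
  have "det B * det A = 1" using B by (metis det_I det_mul)
  with A B show "\<exists>B\<in>carrier SL2R. B \<otimes>\<^bsub>SL2R\<^esub> A = \<one>\<^bsub>SL2R\<^esub>"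
    by (auto simp: SL2R_def)
qed (auto simp: SL2R_def det_mul matrix_mul_assoc)

definition Gam :: "rat \<Rightarrow> (real^2^2) set" where
  "Gam q = generate SL2R {mat2 1 1 0 1, mat2 1 0 (of_rat q) 1}"

text \<open>The ring \<open>\<int>[1/t]\<close>, for \<open>t \<noteq> 0\<close>, as a subring of the reals.\<close>

definition Zinv :: "int \<Rightarrow> real set" where
  "Zinv t = {of_int m / of_int t ^ k | (m::int) (k::nat). True}"

text \<open>\<open>Gam1 t s\<close> is \<open>\<Gamma>\<^sub>1\<^bsup>(t)\<^esup>(s)\<close>.\<close>

definition Gam1 :: "int \<Rightarrow> int \<Rightarrow> (real^2^2) set" where
  "Gam1 t s = {mat2 a b c d | a b c d.
     a \<in> Zinv t \<and> b \<in> Zinv t \<and> c \<in> Zinv t \<and> d \<in> Zinv t \<and>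
     mat2 a b c d \<in> carrier SL2R \<and>
     a - 1 \<in> (*) (of_int s) ` Zinv t \<and>
     d - 1 \<in> (*) (of_int s) ` Zinv t \<and>
     c \<in> (*) (of_int s) ` Zinv t}"

text \<open>\<open>quotient_of\<close> picks the representation in lowest terms with positive denominator;
  replacing \<open>(s, t)\<close> by \<open>(-s, -t)\<close> does not change \<open>Gam1 t s\<close>.\<close>

definition CS :: "rat set" where
  "CS = {q. -4 < q \<and> q < 4 \<and> (case quotient_of q of (s, t) \<Rightarrow> Gam q = Gam1 t s)}"

end

theory Submission
  imports Defs "HOL-Number_Theory.Residues"
begin

text \<open>
  Write \<open>q = s/t\<close> in lowest terms. The inclusion of \<open>Gam q\<close> in \<open>Gam1 t s\<close> always holds, so
  \<open>q \<in> CS\<close> says that \<open>Gam q\<close> is as large as its obvious congruence conditions permit.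
  Dividing \<open>q\<close> by \<open>n\<close> can be done one prime factor at a time, together with the case
  \<open>n = -1\<close>, which is conjugation by \<open>diag(1, -1)\<close>. So let \<open>p\<close> be a prime and
  \<open>H = Gam (q/p)\<close>. As \<open>lower q\<close> is the \<open>p\<close>-th power of \<open>lower (q/p)\<close>, the group \<open>H\<close>
  contains \<open>Gam q = Gam1 t s\<close>, and the question is how much the single further matrix
  \<open>lower (q/p)\<close> adds. There are three cases.

  If \<open>p\<close> divides \<open>s = p s'\<close>, then \<open>H\<close> must be all of \<open>Gam1 t s'\<close>, where only the level has
  dropped. Now \<open>H\<close> contains all elementary matrices of \<open>Gam1 t s'\<close>, and at most three
  elementary row operations move any element of \<open>Gam1 t s'\<close> into \<open>Gam1 t s\<close>: lemma \<open>level_division\<close>.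

  If \<open>p\<close> divides \<open>t\<close>, then \<open>\<int>[1/(t p)] = \<int>[1/t]\<close> and \<open>Gam1 (t p) s = Gam1 t s\<close>, so
  there is nothing to do: lemma \<open>Zinv_absorb\<close>.

  If \<open>p\<close> divides neither, \<open>H\<close> must be the group \<open>Gam1 (t p) s\<close> over a strictly larger ring:
  lemma \<open>prime_inversion\<close>. The geometric reason is that this group acts on the
  Bruhat-Tits tree of \<open>SL\<^sub>2(\<rat>\<^sub>p)\<close> with an edge as fundamental domain. The stabilizer
  of one end of that edge is \<open>Gam1 t s\<close>, the edge stabilizer is maximal in the stabilizer of
  the other end, and \<open>lower (q/p)\<close> fixes that other end but not the edge. The proof follows
  paths in the tree by hand. Multiplying by \<open>lower (s/p)\<close> lowers the \<open>p\<close>-adic content of a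
  first column by one step (lemma \<open>column_descent\<close>), hence a matrix whose first column is
  already free of \<open>p\<close> in its denominators lies in \<open>H\<close> up to a right factor \<open>upper y\<close>
  (lemma \<open>reduce_integral_column\<close>). Applied to \<open>diag(p^j, p^-j)\<close>, this puts into \<open>H\<close>,
  for arbitrarily large \<open>j\<close>, a triangular matrix with this diagonal. Conjugation by it brings
  any given \<open>upper x\<close> over the larger ring into \<open>Gam1 t s\<close> once \<open>j\<close> is large enough, and right
  multiplication by it scales any first column by \<open>p^j\<close>; so both the stray factor \<open>upper y\<close> and the restriction on the first column go away.
\<close>

section \<open>Two by two matrices\<close>

abbreviation upper :: "real \<Rightarrow> real^2^2" where "upper x \<equiv> mat2 1 x 0 1"
abbreviation lower :: "real \<Rightarrow> real^2^2" where "lower x \<equiv> mat2 1 0 x 1"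

lemma mat2_mult:
  "mat2 a b c d ** mat2 a' b' c' d' =
     mat2 (a * a' + b * c') (a * b' + b * d') (c * a' + d * c') (c * b' + d * d')"
  by (simp add: mat2_def matrix_matrix_mult_def vec_eq_iff forall_2 sum_2)

lemma mat2_one: "mat 1 = mat2 1 0 0 1"
  by (simp add: mat2_def mat_def vec_eq_iff forall_2)

lemma det_mat2: "det (mat2 a b c d) = a * d - b * c"
  by (simp add: mat2_def det_2)

lemma mat2_eq_iff: "mat2 a b c d = mat2 a' b' c' d' \<longleftrightarrow> a = a' \<and> b = b' \<and> c = c' \<and> d = d'"
  by (auto simp: mat2_def vec_eq_iff forall_2)

lemma mat2_cases: obtains a b c d where "A = mat2 a b c d"
proof
  show "A = mat2 (A $ 1 $ 1) (A $ 1 $ 2) (A $ 2 $ 1) (A $ 2 $ 2)"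
    by (simp add: mat2_def vec_eq_iff forall_2)
qed

lemma subgroup_mult:
  assumes "subgroup H SL2R" "A \<in> H" "B \<in> H"
  shows "A ** B \<in> H"
  using subgroup.m_closed[OF assms] by (simp add: SL2R_def)

lemma subgroup_inverse:
  assumes H: "subgroup H SL2R" and g: "g \<in> H"
  obtains g' where "g' \<in> H" "g' ** g = mat 1" "g ** g' = mat 1"
proof
  have gc: "g \<in> carrier SL2R" using subgroup.mem_carrier[OF H g] .
  show "inv\<^bsub>SL2R\<^esub> g \<in> H" using subgroup.m_inv_closed[OF H g] .
  show "inv\<^bsub>SL2R\<^esub> g ** g = mat 1" "g ** inv\<^bsub>SL2R\<^esub> g = mat 1"
    using group.l_inv[OF group_SL2R gc] group.r_inv[OF group_SL2R gc] by (simp_all add: SL2R_def)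
qed

lemma subgroup_cancel_left:
  assumes "subgroup H SL2R" "g \<in> H" "g ** A \<in> H"
  shows "A \<in> H"
  using subgroup_inverse[OF assms(1,2)] subgroup_mult[OF assms(1) _ assms(3)]
  by (metis matrix_mul_assoc matrix_mul_lid)

lemma subgroup_cancel_right:
  assumes "subgroup H SL2R" "g \<in> H" "A ** g \<in> H"
  shows "A \<in> H"
  using subgroup_inverse[OF assms(1,2)] subgroup_mult[OF assms(1) assms(3)]
  by (metis matrix_mul_assoc matrix_mul_rid)

lemma subgroup_one:
  assumes "subgroup H SL2R"
  shows "mat2 1 0 0 1 \<in> H"
  using subgroup.one_closed[OF assms] by (simp add: SL2R_def mat2_one)

lemma lower_multiple:
  assumes H: "subgroup H SL2R" and z: "lower z \<in> H"
  shows "lower (of_int m * z) \<in> H"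
proof -
  have nat: "lower (of_nat k * z) \<in> H" for k
  proof (induction k)
    case 0
    show ?case using subgroup_one[OF H] by simp
  next
    case (Suc k)
    from subgroup_mult[OF H z this] show ?case by (simp add: mat2_mult algebra_simps)
  qed
  show ?thesis
  proof (cases "m \<ge> 0")
    case True
    then show ?thesis using nat[of "nat m"] by simp
  next
    case False
    have "lower (of_nat (nat (- m)) * z) ** lower (of_int m * z) = mat2 1 0 0 1"
      using False by (simp add: mat2_mult)
    then show ?thesis using subgroup_cancel_left[OF H nat] subgroup_one[OF H] by metis
  qed
qed

section \<open>The ring of fractions \<open>\<int>[1/t]\<close> and its ideals\<close>

lemma ZinvI: "x = of_int m / of_int t ^ k \<Longrightarrow> x \<in> Zinv t"
  by (auto simp: Zinv_def)

lemma Zinv_of_int: "of_int m \<in> Zinv t"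
  by (rule ZinvI[of _ m _ 0]) simp

lemma Zinv_0: "0 \<in> Zinv t" and Zinv_1: "1 \<in> Zinv t"
  using Zinv_of_int[of 0] Zinv_of_int[of 1] by simp_all

lemma Zinv_mult: assumes "x \<in> Zinv t" "y \<in> Zinv t" shows "x * y \<in> Zinv t"
proof -
  from assms obtain m k n l where "x = of_int m / of_int t ^ k" "y = of_int n / of_int t ^ l"
    by (auto simp: Zinv_def)
  then show ?thesis by (intro ZinvI[of _ "m * n" _ "k + l"]) (simp add: power_add)
qed

lemma Zinv_add: assumes "t \<noteq> 0" "x \<in> Zinv t" "y \<in> Zinv t" shows "x + y \<in> Zinv t"
proof -
  from assms obtain m k n l where "x = of_int m / of_int t ^ k" "y = of_int n / of_int t ^ l"
    by (auto simp: Zinv_def)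
  then show ?thesis using \<open>t \<noteq> 0\<close>
    by (intro ZinvI[of _ "m * t ^ l + n * t ^ k" _ "k + l"]) (simp add: power_add add_divide_distrib)
qed

lemma Zinv_minus: assumes "x \<in> Zinv t" shows "- x \<in> Zinv t"
  using Zinv_mult[OF Zinv_of_int[of "-1"] assms] by simp

lemma Zinv_diff: assumes "t \<noteq> 0" "x \<in> Zinv t" "y \<in> Zinv t" shows "x - y \<in> Zinv t"
  using Zinv_add[OF assms(1,2) Zinv_minus[OF assms(3)]] by simp

lemma Zinv_inverse: "x \<in> Zinv t \<Longrightarrow> x / of_int t \<in> Zinv t"
  using Zinv_mult[of x t "1 / of_int t"] ZinvI[of "1 / of_int t" 1 t 1] by simp

lemma Zinv_power: assumes "x \<in> Zinv t" shows "x ^ k \<in> Zinv t"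
  by (induction k) (auto intro: Zinv_1 Zinv_mult assms)

lemmas Zinv_closed = Zinv_of_int Zinv_0 Zinv_1 Zinv_mult Zinv_add Zinv_minus Zinv_diff Zinv_power

lemma Zinv_mono:
  assumes "p \<noteq> 0" "x \<in> Zinv t" shows "x \<in> Zinv (t * p)"
proof -
  from assms obtain m k where "x = of_int m / of_int t ^ k" by (auto simp: Zinv_def)
  then show ?thesis using \<open>p \<noteq> 0\<close>
    by (intro ZinvI[of _ "m * p ^ k" _ k]) (simp add: power_mult_distrib)
qed

text \<open>The bound \<open>k0\<close> leaves room to clear several denominators with one common power.\<close>

lemma Zinv_clear:
  assumes "p \<noteq> 0" "x \<in> Zinv (t * p)"
  shows "\<exists>k0. \<forall>k\<ge>k0. of_int p ^ k * x \<in> Zinv t"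
proof -
  from assms obtain m l where x: "x = of_int m / of_int (t * p) ^ l" by (auto simp: Zinv_def)
  have "of_int p ^ k * x \<in> Zinv t" if "k \<ge> l" for k
  proof -
    have "(of_int p :: real) ^ k = of_int p ^ (k - l) * of_int p ^ l"
      using that by (simp flip: power_add)
    then show ?thesis using \<open>p \<noteq> 0\<close>
      by (intro ZinvI[of _ "p ^ (k - l) * m" _ l]) (simp add: x power_mult_distrib)
  qed
  then show ?thesis by blast
qed

lemma Zinv_absorb:
  assumes "t \<noteq> 0" "p dvd t" shows "Zinv (t * p) = Zinv t"
proof
  show "Zinv t \<subseteq> Zinv (t * p)" using assms Zinv_mono[of p] by auto
  show "Zinv (t * p) \<subseteq> Zinv t"
  proof
    fix x assume "x \<in> Zinv (t * p)"
    then obtain m k where x: "x = of_int m / of_int (t * p) ^ k" by (auto simp: Zinv_def)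
    obtain r where r: "t = p * r" using assms by auto
    show "x \<in> Zinv t" using assms(1)
      by (intro ZinvI[of _ "m * r ^ k" _ "k + k"])
         (simp add: x r power_add power_mult_distrib field_simps)
  qed
qed

abbreviation multiples :: "int \<Rightarrow> int \<Rightarrow> real set" where
  "multiples t s \<equiv> (*) (of_int s) ` Zinv t"

lemma multiplesI: "x = of_int s * y \<Longrightarrow> y \<in> Zinv t \<Longrightarrow> x \<in> multiples t s"
  by blast

lemma multiples_add:
  assumes "t \<noteq> 0" "x \<in> multiples t s" "y \<in> multiples t s" shows "x + y \<in> multiples t s"
proof -
  from assms obtain u v where "u \<in> Zinv t" "v \<in> Zinv t" "x = of_int s * u" "y = of_int s * v"
    by blast
  then show ?thesis using \<open>t \<noteq> 0\<close> by (intro multiplesI[of _ s "u + v"] Zinv_add) (simp_all add: algebra_simps)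
qed

lemma multiples_mult:
  assumes "x \<in> multiples t s" "y \<in> Zinv t" shows "x * y \<in> multiples t s" "y * x \<in> multiples t s"
proof -
  from assms obtain u where u: "u \<in> Zinv t" "x = of_int s * u" by blast
  show "x * y \<in> multiples t s"
    using u assms by (intro multiplesI[of _ s "u * y"] Zinv_mult) simp_all
  then show "y * x \<in> multiples t s" by (simp add: mult.commute)
qed

lemma multiples_minus: "x \<in> multiples t s \<Longrightarrow> - x \<in> multiples t s"
  using multiples_mult(1)[of x s t "-1"] Zinv_of_int[of "-1" t] by simp

lemma multiples_diff:
  assumes "t \<noteq> 0" "x \<in> multiples t s" "y \<in> multiples t s" shows "x - y \<in> multiples t s"
  using multiples_add[OF assms(1,2) multiples_minus[OF assms(3)]] by simp

lemma multiples_Zinv: "x \<in> multiples t s \<Longrightarrow> x \<in> Zinv t"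
  by (auto intro: Zinv_mult Zinv_of_int)

section \<open>Congruence groups and groups generated by two unipotents\<close>

text \<open>The determinant makes the congruence condition on \<open>d\<close> follow from those on \<open>a\<close> and \<open>c\<close>.
  So membership in \<open>Gam1 t s\<close> depends, within \<open>SL\<^sub>2(\<int>[1/t])\<close>, on the first column alone, which
  is why row reduction of the first column suffices later on.\<close>

lemma Gam1I:
  assumes t: "t \<noteq> 0" and R: "a \<in> Zinv t" "b \<in> Zinv t" "d \<in> Zinv t"
    and det: "a * d - b * c = 1"
    and a: "a - 1 \<in> multiples t s" and c: "c \<in> multiples t s"
  shows "mat2 a b c d \<in> Gam1 t s"
proof -
  have "d - 1 = b * c - (a - 1) * d" using det by (simp add: algebra_simps)
  also have "\<dots> \<in> multiples t s"
    by (intro multiples_diff[OF t] multiples_mult a c R)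
  finally show ?thesis
    using R det a c multiples_Zinv[OF c]
    unfolding Gam1_def by (fastforce simp: SL2R_def det_mat2)
qed

lemma Gam1D:
  assumes "mat2 a b c d \<in> Gam1 t s"
  shows "a \<in> Zinv t" "b \<in> Zinv t" "c \<in> Zinv t" "d \<in> Zinv t" "a * d - b * c = 1"
    "a - 1 \<in> multiples t s" "c \<in> multiples t s" "d - 1 \<in> multiples t s"
  using assms unfolding Gam1_def by (auto simp: SL2R_def det_mat2 mat2_eq_iff)

lemma Gam1_mult:
  assumes t: "t \<noteq> 0" and A: "A \<in> Gam1 t s" and B: "B \<in> Gam1 t s"
  shows "A ** B \<in> Gam1 t s"
proof -
  obtain a b c d where A': "A = mat2 a b c d" by (rule mat2_cases)
  obtain a' b' c' d' where B': "B = mat2 a' b' c' d'" by (rule mat2_cases)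
  note a = Gam1D[OF A[unfolded A']] and b = Gam1D[OF B[unfolded B']]
  show ?thesis unfolding A' B' mat2_mult
  proof (rule Gam1I[OF t])
    show "(a * a' + b * c') * (c * b' + d * d') - (a * b' + b * d') * (c * a' + d * c') = 1"
    proof -
      have "(a * a' + b * c') * (c * b' + d * d') - (a * b' + b * d') * (c * a' + d * c')
          = (a * d - b * c) * (a' * d' - b' * c')" by (simp add: algebra_simps)
      then show ?thesis using a(5) b(5) by simp
    qed
    have "a * a' + b * c' - 1 = ((a - 1) * a' + b * c') + (a' - 1)" by (simp add: algebra_simps)
    also have "\<dots> \<in> multiples t s"
      by (intro multiples_add[OF t] multiples_mult a b)
    finally show "a * a' + b * c' - 1 \<in> multiples t s" .
    show "c * a' + d * c' \<in> multiples t s"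
      by (intro multiples_add[OF t] multiples_mult a b)
  qed (intro Zinv_add t Zinv_mult a b)+
qed

lemma Gam1_subgroup:
  assumes t: "t \<noteq> 0"
  shows "subgroup (Gam1 t s) SL2R"
proof (rule group.subgroupI[OF group_SL2R])
  show "Gam1 t s \<subseteq> carrier SL2R" by (auto simp: Gam1_def)
  have "mat2 1 0 0 1 \<in> Gam1 t s"
    by (rule Gam1I[OF t]) (auto intro!: Zinv_closed multiplesI[of _ s 0])
  then show "Gam1 t s \<noteq> {}" by blast
next
  fix A assume A: "A \<in> Gam1 t s"
  obtain a b c d where A': "A = mat2 a b c d" by (rule mat2_cases)
  note a = Gam1D[OF A[unfolded A']]
  have i: "mat2 d (-b) (-c) a \<in> Gam1 t s"
  proof (rule Gam1I[OF t])
    show "d * a - - b * - c = 1" using a(5) by (simp add: algebra_simps)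
  qed (intro Zinv_minus multiples_minus a)+
  have "mat2 d (-b) (-c) a ** A = mat 1"
    unfolding A' mat2_mult mat2_one mat2_eq_iff using a(5) by (simp add: algebra_simps)
  then have "inv\<^bsub>SL2R\<^esub> A = mat2 d (-b) (-c) a"
    using i A by (intro group.inv_equality[OF group_SL2R]) (auto simp: SL2R_def Gam1_def)
  with i show "inv\<^bsub>SL2R\<^esub> A \<in> Gam1 t s" by simp
next
  fix A B assume "A \<in> Gam1 t s" "B \<in> Gam1 t s"
  then show "A \<otimes>\<^bsub>SL2R\<^esub> B \<in> Gam1 t s" using Gam1_mult[OF t] by (simp add: SL2R_def)
qed

lemma upper_Gam1: "t \<noteq> 0 \<Longrightarrow> x \<in> Zinv t \<Longrightarrow> upper x \<in> Gam1 t s"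
  by (rule Gam1I) (auto intro!: Zinv_closed multiplesI[of _ s 0])

lemma lower_Gam1: "t \<noteq> 0 \<Longrightarrow> x \<in> Zinv t \<Longrightarrow> lower (of_int s * x) \<in> Gam1 t s"
  by (rule Gam1I) (auto intro!: Zinv_closed multiplesI[of 0 s 0])

lemma generators_carrier: "{upper 1, lower x} \<subseteq> carrier SL2R"
  by (auto simp: SL2R_def det_mat2)

lemma Gam_subgroup: "subgroup (Gam q) SL2R"
  unfolding Gam_def by (rule group.generate_is_subgroup[OF group_SL2R generators_carrier])

lemma Gam_generators: "upper 1 \<in> Gam q" "lower (of_rat q) \<in> Gam q"
  unfolding Gam_def by (auto intro: generate.incl)

lemma Gam_least:
  assumes "subgroup H SL2R" "upper 1 \<in> H" "lower (of_rat q) \<in> H"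
  shows "Gam q \<subseteq> H"
  unfolding Gam_def using assms by (intro group.generate_subgroup_incl[OF group_SL2R]) auto

lemma Gam_subset_Gam1:
  assumes "t \<noteq> 0"
  shows "Gam (of_int s / of_int t) \<subseteq> Gam1 t s"
proof (rule Gam_least[OF Gam1_subgroup[OF assms]])
  show "upper 1 \<in> Gam1 t s" using assms Zinv_1 by (rule upper_Gam1)
  show "lower (of_rat (of_int s / of_int t)) \<in> Gam1 t s"
    using lower_Gam1[OF assms Zinv_inverse[OF Zinv_1], of s] by (simp add: of_rat_divide)
qed

section \<open>Residues modulo a prime that is not inverted\<close>

locale prime_away =
  fixes t p :: int
  assumes t_nz: "t \<noteq> 0" and prime_p: "prime p" and p_ndvd_t: "\<not> p dvd t"
begin

abbreviation R :: "real set" where "R \<equiv> Zinv t"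
abbreviation pR :: "real set" where "pR \<equiv> multiples t p"

lemma p_nz: "p \<noteq> 0" using prime_p by auto

text \<open>Since \<open>t\<close> is invertible modulo \<open>p\<close>, the integers already represent all of \<open>R/pR = \<int>/p\<int>\<close>.
  In particular \<open>pR\<close> is a maximal ideal, which the next lemmas spell out.\<close>

lemma residue:
  assumes "x \<in> R"
  obtains m :: int and y where "y \<in> R" "x = of_int m + of_int p * y"
proof -
  from assms obtain m k where x: "x = of_int m / of_int t ^ k" by (auto simp: Zinv_def)
  have "coprime p t" using prime_p p_ndvd_t by (simp add: prime_imp_coprime)
  then have "coprime p (t ^ k)" by simp
  then obtain u v where uv: "u * p + v * t ^ k = 1"
    by (metis bezout_int coprime_iff_gcd_eq_1)
  show thesis
  proof (rule that[of "of_int (m * u) / of_int t ^ k" "m * v"])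
    show "of_int (m * u) / of_int t ^ k \<in> R" by (rule ZinvI) (rule refl)
    have "m = m * (u * p + v * t ^ k)" using uv by simp
    then have "m = m * v * t ^ k + p * (m * u)" by (simp add: algebra_simps)
    then have "(of_int m :: real) = of_int (m * v * t ^ k + p * (m * u))" by simp
    then show "x = of_int (m * v) + of_int p * (of_int (m * u) / of_int t ^ k)"
      using t_nz by (simp add: x field_simps)
  qed
qed

lemma unit_mod_p:
  assumes "x \<in> R" "x \<notin> pR"
  obtains u y where "u \<in> R" "y \<in> R" "x * u = 1 + of_int p * y"
proof -
  obtain m y where y: "y \<in> R" "x = of_int m + of_int p * y" using residue[OF assms(1)] .
  have "\<not> p dvd m"
  proof
    assume "p dvd m"
    then obtain r where "m = p * r" by auto
    then have "x = of_int p * (of_int r + y)" using y by (simp add: algebra_simps)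
    then show False using assms(2) y Zinv_add[OF t_nz Zinv_of_int[of r]] by blast
  qed
  then have "coprime p m" using prime_p by (simp add: prime_imp_coprime)
  then obtain u v where uv: "u * p + v * m = 1"
    by (metis bezout_int coprime_iff_gcd_eq_1)
  show thesis
  proof (rule that[of "of_int v" "y * of_int v - of_int u"])
    have "(of_int v * of_int m :: real) = of_int (1 - u * p)" using uv by (simp flip: of_int_mult)
    then show "x * of_int v = 1 + of_int p * (y * of_int v - of_int u)"
      by (simp add: y algebra_simps)
  qed (intro Zinv_closed t_nz y)+
qed

lemma one_notin_pR: "1 \<notin> pR"
proof
  assume "1 \<in> pR"
  then obtain m k where "1 = of_int p * (of_int m / of_int t ^ k :: real)" by (auto simp: Zinv_def)
  then have "(of_int (t ^ k) :: real) = of_int (p * m)" using t_nz by (simp add: field_simps)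
  then have "t ^ k = p * m" using of_int_eq_iff by blast
  then have "p dvd t ^ k" by simp
  then show False using prime_p p_ndvd_t prime_dvd_power by blast
qed

lemma pR_prime:
  assumes "x \<in> R" "y \<in> R" "x * y \<in> pR" "x \<notin> pR"
  shows "y \<in> pR"
proof -
  obtain u z where u: "u \<in> R" "z \<in> R" "x * u = 1 + of_int p * z"
    using unit_mod_p[OF assms(1,4)] .
  have "x * y * u - of_int p * (z * y) = (x * u) * y - of_int p * z * y" by simp
  then have "y = x * y * u - of_int p * (z * y)" unfolding u(3) by (simp add: algebra_simps)
  also have "\<dots> \<in> pR"
    by (intro multiples_diff[OF t_nz] multiples_mult(1)[OF assms(3)] u)
       (auto intro!: Zinv_mult u assms)
  finally show ?thesis .
qed

lemma of_int_notin_pR: assumes "\<not> p dvd s" shows "of_int s \<notin> pR"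
proof
  assume *: "of_int s \<in> pR"
  have "coprime p s" using prime_p assms by (simp add: prime_imp_coprime)
  then obtain u v where uv: "u * p + v * s = 1"
    by (metis bezout_int coprime_iff_gcd_eq_1)
  have "(1::real) = of_int (u * p + v * s)" by (simp only: uv of_int_1)
  also have "\<dots> = of_int p * of_int u + of_int v * of_int s" by simp
  also have "\<dots> \<in> pR"
    by (intro multiples_add[OF t_nz] multiples_mult(2)[OF *] multiplesI[OF refl] Zinv_of_int)
  finally show False using one_notin_pR by simp
qed

text \<open>Multiples of the generator give only the lower entries \<open>m s/(t p)\<close> with \<open>m\<close> an integer. By
  \<open>residue\<close>, every \<open>t x\<close> is an integer up to an element of \<open>pR\<close>, and the error is
  a lower matrix of \<open>Gam1 t s\<close>.\<close>

lemma lower_over_p: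
  assumes H: "subgroup H SL2R" and sub: "Gam1 t s \<subseteq> H"
    and gen: "lower (of_int s / (of_int t * of_int p)) \<in> H" and x: "x \<in> R"
  shows "lower (of_int s * x / of_int p) \<in> H"
proof -
  have "of_int t * x \<in> R" by (intro Zinv_mult Zinv_of_int x)
  then obtain m y where y: "y \<in> R" "of_int t * x = of_int m + of_int p * y" by (rule residue)
  have "lower (of_int m * (of_int s / (of_int t * of_int p))) ** lower (of_int s * (y / of_int t)) \<in> H"
    using subgroup_mult[OF H lower_multiple[OF H gen]] sub lower_Gam1[OF t_nz Zinv_inverse[OF y(1)]]
    by blast
  also have "lower (of_int m * (of_int s / (of_int t * of_int p))) ** lower (of_int s * (y / of_int t))
      = lower (of_int s * (of_int m + of_int p * y) / (of_int t * of_int p))"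
    using t_nz p_nz by (simp add: mat2_mult mat2_eq_iff field_simps)
  also have "\<dots> = lower (of_int s * x / of_int p)"
    using t_nz p_nz by (simp flip: y(2))
  finally show ?thesis .
qed

section \<open>Dividing the level by a prime\<close>

text \<open>Let the first column be \<open>a = 1 + s e\<close>, \<open>c = s g\<close>; it has to become \<open>(1, 0)\<close> modulo \<open>p s\<close>.
  If \<open>g\<close> is a unit modulo \<open>p\<close>, adding a multiple of \<open>c\<close> to \<open>a\<close> turns \<open>e\<close> into a multiple
  of \<open>p\<close>; after that \<open>a\<close> is \<open>1\<close> modulo \<open>p\<close>, and subtracting \<open>s g\<close> times the first row clears \<open>c\<close>. If instead
  \<open>p\<close> divides \<open>g\<close>, the determinant forces \<open>a\<close> to be a unit modulo \<open>p\<close>, and one preliminary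
  addition of \<open>s a\<close> to \<open>c\<close> leads back to the first situation. Working with \<open>e\<close> and \<open>g\<close>
  rather than with \<open>a\<close> and \<open>c\<close> treats \<open>p dvd s\<close> and \<open>\<not> p dvd s\<close> alike.\<close>

lemma level_division:
  assumes H: "subgroup H SL2R" and sub: "Gam1 t (p * s) \<subseteq> H"
    and gen: "lower (of_int s / of_int t) \<in> H"
  shows "Gam1 t s \<subseteq> H"
proof
  have U: "upper x \<in> H" if "x \<in> R" for x
    using sub upper_Gam1[OF t_nz that] by blast
  have L: "lower (of_int s * x) \<in> H" if "x \<in> R" for x
    using lower_over_p[OF H sub _ that] gen p_nz by simp
  have top_done: "mat2 a b c d \<in> H"
    if A: "mat2 a b c d \<in> Gam1 t s" and a1: "a - 1 \<in> multiples t (p * s)" for a b c d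
  proof -
    note A' = Gam1D[OF A]
    obtain g where g: "g \<in> R" "c = of_int s * g" using A' by blast
    obtain e where e: "e \<in> R" "a = 1 + of_int (p * s) * e" using a1 by (auto simp: algebra_simps)
    have "lower (of_int s * (- g)) ** mat2 a b c d
        = mat2 a b (c - of_int s * g * a) (d - of_int s * g * b)"
      by (simp add: mat2_mult)
    also have "\<dots> \<in> Gam1 t (p * s)"
    proof (rule Gam1I[OF t_nz])
      show "a * (d - of_int s * g * b) - b * (c - of_int s * g * a) = 1" using A'(5) by (simp add: algebra_simps)
      show "c - of_int s * g * a \<in> multiples t (p * s)"
        by (rule multiplesI[of _ _ "- (g * of_int s * e)"])
           (auto intro!: Zinv_closed g e simp: g(2) e(2) algebra_simps)
    qed (intro A' a1 Zinv_closed t_nz g)+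
    finally show ?thesis using subgroup_cancel_left[OF H L[OF Zinv_minus[OF g(1)]]] sub by blast
  qed
  have unit_below: "mat2 a b c d \<in> H"
    if A: "mat2 a b c d \<in> Gam1 t s" and g: "g \<in> R" "c = of_int s * g" "g \<notin> pR" for a b c d g
  proof -
    note A' = Gam1D[OF A]
    obtain e where e: "e \<in> R" "a = 1 + of_int s * e" using A'(6) by (auto simp: algebra_simps)
    obtain u y where u: "u \<in> R" "y \<in> R" "g * u = 1 + of_int p * y"
      using unit_mod_p[OF g(1,3)] .
    have x: "- (e * u) \<in> R" by (intro Zinv_closed e u)
    have eq: "upper (- (e * u)) ** mat2 a b c d = mat2 (a - e * u * c) (b - e * u * d) c d"
      by (simp add: mat2_mult)
    have "a - e * u * c = 1 + of_int s * e - of_int s * e * (g * u)" by (simp add: e g)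
    also have "\<dots> = 1 - of_int (p * s) * (e * y)" by (simp add: u algebra_simps)
    finally have "a - e * u * c - 1 = of_int (p * s) * (- (e * y))" by simp
    then have "a - e * u * c - 1 \<in> multiples t (p * s)"
      by (rule multiplesI) (intro Zinv_closed e u)
    moreover have "mat2 (a - e * u * c) (b - e * u * d) c d \<in> Gam1 t s"
      using Gam1_mult[OF t_nz upper_Gam1[OF t_nz x] A] eq by simp
    ultimately show ?thesis using top_done eq subgroup_cancel_left[OF H U[OF x]] by metis
  qed
  fix A assume A: "A \<in> Gam1 t s"
  obtain a b c d where A': "A = mat2 a b c d" by (rule mat2_cases)
  note a = Gam1D[OF A[unfolded A']]
  obtain g where g: "g \<in> R" "c = of_int s * g" using a by blast
  show "A \<in> H"
  proof (cases "g \<in> pR")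
    case False
    then show ?thesis using unit_below A A' g by blast
  next
    case True
    have eq: "lower (of_int s * 1) ** A = mat2 a b (of_int s * (g + a)) (of_int s * b + d)"
      by (simp add: A' mat2_mult g algebra_simps)
    have "a \<notin> pR"
    proof
      assume "a \<in> pR"
      then have "a * d - b * (of_int s * g) \<in> pR"
        by (intro multiples_diff[OF t_nz] multiples_mult True a Zinv_of_int)
      then show False using a(5) g one_notin_pR by simp
    qed
    then have "g + a \<notin> pR" using multiples_diff[OF t_nz _ True, of "g + a"] by auto
    moreover have "g + a \<in> R" by (intro Zinv_closed t_nz g a)
    moreover have "mat2 a b (of_int s * (g + a)) (of_int s * b + d) \<in> Gam1 t s"
      using Gam1_mult[OF t_nz lower_Gam1[OF t_nz Zinv_1] A] eq by metis
    ultimately have "lower (of_int s * 1) ** A \<in> H" using unit_below eq by metis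
    then show ?thesis using subgroup_cancel_left[OF H L[OF Zinv_1]] by blast
  qed
qed

section \<open>Adjoining the inverse of a prime\<close>

text \<open>The exponent \<open>m\<close> is the distance that \<open>column_descent\<close> will have to cover. Pulling out
  factors of \<open>p\<close> stops because the ideal generated by \<open>a\<close> and \<open>c\<close> contains \<open>p^k\<close>.\<close>

lemma primitive_part:
  assumes "a \<in> R" "c \<in> R" "B \<in> R" "D \<in> R" "a * D - B * c = of_int p ^ k"
  obtains m a' c' where "a' \<in> R" "c' \<in> R" "a = of_int p ^ m * a'" "c = of_int p ^ m * c'"
    "a' \<notin> pR \<or> c' \<notin> pR"
  using assms
proof (induction k arbitrary: a c thesis)
  case (0 a c)
  have "a \<notin> pR \<or> c \<notin> pR"
  proof (rule ccontr)
    assume "\<not> ?thesis"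
    then have "a * D - B * c \<in> pR"
      using 0 by (intro multiples_diff[OF t_nz] multiples_mult) auto
    then show False using one_notin_pR 0 by simp
  qed
  then show ?case using "0.prems"(1)[of a c 0] 0 by simp
next
  case (Suc k a c)
  show ?case
  proof (cases "a \<in> pR \<and> c \<in> pR")
    case False
    then show ?thesis using Suc.prems(1)[of a c 0] Suc.prems by simp
  next
    case True
    then obtain a1 c1 where *: "a1 \<in> R" "c1 \<in> R" "a = of_int p * a1" "c = of_int p * c1" by blast
    have "of_int p * (a1 * D - B * c1) = of_int p * of_int p ^ k"
      using Suc.prems(6) by (simp add: * algebra_simps)
    then have "a1 * D - B * c1 = of_int p ^ k" using p_nz by simp
    from Suc.IH[OF _ *(1,2) Suc.prems(4,5) this] obtain m a' c'
      where "a' \<in> R" "c' \<in> R" "a1 = of_int p ^ m * a'" "c1 = of_int p ^ m * c'" "a' \<notin> pR \<or> c' \<notin> pR"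
      by blast
    then show ?thesis using Suc.prems(1)[of a' c' "Suc m"] * by simp
  qed
qed

text \<open>The ideal generated by \<open>a\<close> and \<open>c\<close> contains \<open>p^k\<close> and, as it is not inside the maximal ideal
  \<open>pR\<close>, also some \<open>1 + p y\<close>. These two elements are coprime: the identity
  \<open>p^k = p^k (1 + p y) - y p^(k+1)\<close> lowers \<open>k\<close> step by step to \<open>0\<close>.\<close>

lemma unimodular_completion:
  assumes R: "a \<in> R" "c \<in> R" and prim: "a \<notin> pR \<or> c \<notin> pR"
    and BD: "B \<in> R" "D \<in> R" "a * D - B * c = of_int p ^ k"
  obtains B' D' where "B' \<in> R" "D' \<in> R" "a * D' - B' * c = 1"
proof -
  obtain v w y where v: "v \<in> R" "w \<in> R" "y \<in> R" "a * v - w * c = 1 + of_int p * y"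
  proof (cases "a \<in> pR")
    case False
    then obtain u y where "u \<in> R" "y \<in> R" "a * u = 1 + of_int p * y"
      using unit_mod_p R by blast
    then show thesis using that[of u 0 y] Zinv_0 by simp
  next
    case True
    then obtain u y where "u \<in> R" "y \<in> R" "c * u = 1 + of_int p * y"
      using unit_mod_p R prim by blast
    then show thesis using that[of 0 "- u" y] Zinv_0 Zinv_minus by (simp add: mult.commute)
  qed
  have "\<exists>B'\<in>R. \<exists>D'\<in>R. a * D' - B' * c = 1"
    using BD
  proof (induction k arbitrary: B D)
    case 0
    then show ?case by auto
  next
    case (Suc k B D)
    have "a * (of_int p ^ k * v - y * D) - (of_int p ^ k * w - y * B) * c
        = of_int p ^ k * (a * v - w * c) - y * (a * D - B * c)" by (simp add: algebra_simps)
    also have "\<dots> = of_int p ^ k" unfolding v(4) Suc.prems(3) by (simp add: algebra_simps)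
    finally show ?case
      by (rule Suc.IH[rotated 2]) (intro Zinv_closed t_nz v Suc.prems)+
  qed
  then show thesis using that by blast
qed

text \<open>Congruences modulo \<open>s\<close> over the larger ring restrict to congruences over \<open>R\<close>, because \<open>p\<close> is
  invertible modulo \<open>s\<close>.\<close>

lemma multiples_descend:
  assumes s: "\<not> p dvd s" and x: "x \<in> R" "x \<in> multiples (t * p) s"
  shows "x \<in> multiples t s"
proof -
  obtain z where z: "z \<in> Zinv (t * p)" "x = of_int s * z" using x by blast
  obtain k where k: "of_int p ^ k * z \<in> R" using Zinv_clear[OF p_nz z(1)] by blast
  have "coprime p s" using prime_p s by (simp add: prime_imp_coprime)
  then have "coprime (p ^ k) s" by simp
  then obtain u v where uv: "u * p ^ k + v * s = 1"
    by (metis bezout_int coprime_iff_gcd_eq_1)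
  have "z = of_int (u * p ^ k + v * s) * z" using uv by simp
  also have "\<dots> = of_int u * (of_int p ^ k * z) + of_int v * x" by (simp add: z algebra_simps)
  also have "\<dots> \<in> R" by (intro Zinv_closed t_nz k x)
  finally show ?thesis using z by blast
qed

text \<open>One step towards the base point of the tree. With \<open>a\<close> a unit modulo \<open>p\<close> (arranged by
  adding \<open>c\<close> if necessary), adding \<open>(s/p) p^(m+1) a\<close> to the lower entry \<open>p^(m+1) c\<close> yields
  \<open>p^m (p c + s a)\<close>, and \<open>p c + s a\<close> is a unit modulo \<open>p\<close> because \<open>s\<close> and \<open>a\<close> are. Thus the
  column is \<open>p^m\<close> times a column not divisible by \<open>p\<close>. The second column is only
  carried along.\<close>

lemma column_descent:
  assumes H: "subgroup H SL2R" and s: "\<not> p dvd s"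
    and U: "\<And>x. x \<in> R \<Longrightarrow> upper x \<in> H"
    and L: "\<And>x. x \<in> R \<Longrightarrow> lower (of_int s * x / of_int p) \<in> H"
    and R: "a \<in> R" "c \<in> R" and prim: "a \<notin> pR \<or> c \<notin> pR"
  obtains h a' b' c' d' where "h \<in> H" "h ** mat2 (of_int p ^ m * a) b (of_int p ^ m * c) d = mat2 a' b' c' d'"
    "a' \<in> R" "c' \<in> R" "a' \<notin> pR \<or> c' \<notin> pR"
  using R prim
proof (induction m arbitrary: a b c d thesis)
  case 0
  show ?case
    by (rule "0.prems"(1)[OF subgroup_one[OF H] _ "0.prems"(2-4)]) (simp add: mat2_mult)
next
  case (Suc m a b c d)
  obtain x where x: "x \<in> R" "a + x * c \<notin> pR"
  proof (cases "a \<in> pR")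
    case False
    then show thesis using that[of 0] Zinv_0 by simp
  next
    case True
    have "a + c \<notin> pR"
    proof
      assume "a + c \<in> pR"
      then have "a + c - a \<in> pR" using True by (rule multiples_diff[OF t_nz])
      then show False using Suc.prems(4) True by simp
    qed
    then show thesis using that[of 1] Zinv_1 by simp
  qed
  define a0 where "a0 = a + x * c"
  have a0: "a0 \<in> R" "a0 \<notin> pR" unfolding a0_def by (intro Zinv_closed t_nz Suc.prems x) (rule x)
  define b0 where "b0 = b + x * d"
  define d0 where "d0 = of_int s / of_int p * b0 + d"
  define c1 where "c1 = of_int p * c + of_int s * a0"
  have c1: "c1 \<in> R" unfolding c1_def by (intro Zinv_closed t_nz Suc.prems a0)
  have c1p: "c1 \<notin> pR"
  proof
    assume "c1 \<in> pR"
    moreover have "of_int p * c \<in> pR" using Suc.prems(3) by (rule multiplesI[OF refl])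
    ultimately have "c1 - of_int p * c \<in> pR" by (rule multiples_diff[OF t_nz])
    then have "of_int s * a0 \<in> pR" by (simp add: c1_def)
    then show False using pR_prime of_int_notin_pR[OF s] a0 Zinv_of_int by blast
  qed
  have step: "lower (of_int s * 1 / of_int p) **
      (upper x ** mat2 (of_int p ^ Suc m * a) b (of_int p ^ Suc m * c) d)
      = mat2 (of_int p ^ m * (of_int p * a0)) b0 (of_int p ^ m * c1) d0"
    using p_nz by (simp add: mat2_mult mat2_eq_iff a0_def b0_def d0_def c1_def field_simps)
  have g: "lower (of_int s * 1 / of_int p) ** upper x \<in> H"
    by (intro subgroup_mult[OF H] L U Zinv_1 x)
  have pa0: "of_int p * a0 \<in> R" by (intro Zinv_closed a0)
  obtain h a' b' c' d' where h: "h \<in> H"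
      "h ** mat2 (of_int p ^ m * (of_int p * a0)) b0 (of_int p ^ m * c1) d0 = mat2 a' b' c' d'"
      "a' \<in> R" "c' \<in> R" "a' \<notin> pR \<or> c' \<notin> pR"
    by (rule Suc.IH[OF _ pa0 c1 disjI2[OF c1p]])
  show ?case
    by (rule Suc.prems(1)[OF subgroup_mult[OF H h(1) g] _ h(3-5)])
       (simp only: h(2) step matrix_mul_assoc [symmetric])
qed

lemma tp_nz: "t * p \<noteq> 0" using t_nz p_nz by simp

text \<open>After the descent the first column is primitive over \<open>R\<close>, so it is also the first column of
  an element of \<open>Gam1 t s\<close>. Two matrices of determinant one with the same first column differ
  by a right factor \<open>upper y\<close>.\<close>

lemma reduce_integral_column:
  assumes H: "subgroup H SL2R" and s: "\<not> p dvd s" and sub: "Gam1 t s \<subseteq> H" "H \<subseteq> Gam1 (t * p) s"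
    and L: "\<And>x. x \<in> R \<Longrightarrow> lower (of_int s * x / of_int p) \<in> H"
    and A: "mat2 a b c d \<in> Gam1 (t * p) s" and R: "a \<in> R" "c \<in> R"
  obtains y where "y \<in> Zinv (t * p)" "mat2 a b c d ** upper y \<in> H"
proof -
  have U: "upper x \<in> H" if "x \<in> R" for x using sub upper_Gam1[OF t_nz that] by blast
  have clear: "\<exists>k. \<exists>B\<in>R. \<exists>D\<in>R. a * D - B * c = of_int p ^ k"
    if "mat2 a b c d \<in> Gam1 (t * p) s" for a b c d
  proof -
    note A' = Gam1D[OF that]
    obtain k l where k: "\<forall>i\<ge>k. of_int p ^ i * b \<in> R" and l: "\<forall>i\<ge>l. of_int p ^ i * d \<in> R"
      using Zinv_clear[OF p_nz A'(2)] Zinv_clear[OF p_nz A'(4)] by blast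
    have "a * (of_int p ^ (k + l) * d) - (of_int p ^ (k + l) * b) * c = of_int p ^ (k + l) * (a * d - b * c)"
      by (simp add: algebra_simps)
    also have "\<dots> = of_int p ^ (k + l)" using A'(5) by simp
    finally show ?thesis using k l le_add1 le_add2 by blast
  qed
  obtain k B D where BD: "B \<in> R" "D \<in> R" "a * D - B * c = of_int p ^ k" using clear[OF A] by blast
  obtain m a0 c0 where p0: "a0 \<in> R" "c0 \<in> R" "a = of_int p ^ m * a0" "c = of_int p ^ m * c0"
     "a0 \<notin> pR \<or> c0 \<notin> pR"
    using primitive_part[OF R BD] .
  obtain h a' b' c' d' where h: "h \<in> H" "h ** mat2 a b c d = mat2 a' b' c' d'"
      "a' \<in> R" "c' \<in> R" "a' \<notin> pR \<or> c' \<notin> pR"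
    using column_descent[OF H s U L p0(1,2,5)] unfolding p0(3,4) by blast
  have hA: "mat2 a' b' c' d' \<in> Gam1 (t * p) s"
    using Gam1_mult[OF tp_nz] h sub A by (metis subsetD)
  note hA' = Gam1D[OF hA]
  obtain k' B' D' where "B' \<in> R" "D' \<in> R" "a' * D' - B' * c' = of_int p ^ k'"
    using clear[OF hA] by blast
  then obtain B1 D1 where B1: "B1 \<in> R" "D1 \<in> R" "a' * D1 - B1 * c' = 1"
    using unimodular_completion[OF h(3-5)] by blast
  have v: "mat2 a' B1 c' D1 \<in> Gam1 t s"
  proof (rule Gam1I[OF t_nz])
    show "a' - 1 \<in> multiples t s"
      by (rule multiples_descend[OF s _ hA'(6)]) (intro Zinv_closed t_nz h)
    show "c' \<in> multiples t s" by (rule multiples_descend[OF s h(4) hA'(7)])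
  qed (use B1 h in auto)
  define y where "y = d' * B1 - b' * D1"
  have "mat2 a' b' c' d' ** upper y = mat2 a' B1 c' D1"
  proof -
    have "a' * y + b' = B1 * (a' * d' - b' * c') - b' * (a' * D1 - B1 * c' - 1)"
      "c' * y + d' = D1 * (a' * d' - b' * c') - d' * (a' * D1 - B1 * c' - 1)"
      by (simp_all add: y_def algebra_simps)
    then show ?thesis unfolding B1(3) hA'(5) by (simp add: mat2_mult)
  qed
  then have "h ** (mat2 a b c d ** upper y) = mat2 a' B1 c' D1"
    by (simp add: matrix_mul_assoc h(2))
  then have "mat2 a b c d ** upper y \<in> H"
    using subgroup_cancel_left[OF H h(1)] v sub(1) by (metis subsetD)
  moreover have "y \<in> Zinv (t * p)" unfolding y_def
    by (intro Zinv_diff[OF tp_nz] Zinv_mult hA' Zinv_mono[OF p_nz] B1)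
  ultimately show thesis using that by blast
qed

lemma power_one_mod:
  assumes "\<not> p dvd s"
  obtains j where "j \<ge> k" "s dvd p ^ j - 1"
proof -
  have s0: "s \<noteq> 0" using assms by auto
  have "coprime p s" using prime_p assms by (simp add: prime_imp_coprime)
  then have "coprime (nat p) (nat \<bar>s\<bar>)"
    using prime_gt_0_int[OF prime_p] by (simp add: coprime_int_iff [symmetric])
  then have "[nat p ^ totient (nat \<bar>s\<bar>) = 1] (mod nat \<bar>s\<bar>)" by (rule euler_theorem)
  then have "[(nat p ^ totient (nat \<bar>s\<bar>)) ^ k = 1 ^ k] (mod nat \<bar>s\<bar>)" by (rule cong_pow)
  then have "[int (nat p ^ (totient (nat \<bar>s\<bar>) * k)) = int 1] (mod int (nat \<bar>s\<bar>))"
    unfolding cong_int_iff by (simp add: power_mult)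
  then have "[p ^ (totient (nat \<bar>s\<bar>) * k) = 1] (mod \<bar>s\<bar>)"
    using prime_gt_0_int[OF prime_p] by simp
  then have "s dvd p ^ (totient (nat \<bar>s\<bar>) * k) - 1"
    by (simp add: cong_iff_dvd_diff)
  moreover have "totient (nat \<bar>s\<bar>) * k \<ge> k" using s0 by (simp add: Suc_le_eq)
  ultimately show thesis using that by blast
qed

text \<open>The matrices \<open>?g\<close> with diagonal \<open>p^j\<close>, \<open>p^-j\<close> do all the work. Their exact upper right entry
  is unknown but irrelevant: conjugating \<open>upper x\<close> by them multiplies \<open>x\<close> by a power of \<open>p\<close>
  whatever that entry is, and multiplying by them on the right scales the first column.\<close>

lemma prime_inversion:
  assumes H: "subgroup H SL2R" and s: "\<not> p dvd s" and sub: "Gam1 t s \<subseteq> H" "H \<subseteq> Gam1 (t * p) s"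
    and gen: "lower (of_int s / (of_int t * of_int p)) \<in> H"
  shows "Gam1 (t * p) s \<subseteq> H"
proof
  have reduce: "\<exists>y\<in>Zinv (t * p). mat2 a b c d ** upper y \<in> H"
    if "mat2 a b c d \<in> Gam1 (t * p) s" "a \<in> R" "c \<in> R" for a b c d
    using reduce_integral_column[OF H s sub lower_over_p[OF H sub(1) gen] that] by blast
  have pinv: "inverse (of_int p) \<in> Zinv (t * p)"
    by (rule ZinvI[of _ t _ 1]) (use t_nz p_nz in \<open>simp add: field_simps\<close>)
  \<comment> \<open>The exponent must satisfy \<open>p^j = 1\<close> modulo \<open>s\<close> for the diagonal matrix to lie in the
    congruence group; \<open>power_one_mod\<close> supplies arbitrarily large ones.\<close>
  have diag: "\<exists>j\<ge>k. \<exists>y. mat2 (of_int p ^ j) y 0 (inverse (of_int p) ^ j) \<in> H" for k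
  proof -
    obtain j where j: "j \<ge> k" "s dvd p ^ j - 1" using power_one_mod[OF s] .
    then obtain r where "p ^ j - 1 = s * r" by auto
    then have r: "of_int p ^ j - 1 = of_int s * (of_int r :: real)"
      by (metis of_int_1 of_int_diff of_int_mult of_int_power)
    have "mat2 (of_int p ^ j) 0 0 (inverse (of_int p) ^ j) \<in> Gam1 (t * p) s"
    proof (rule Gam1I[OF tp_nz])
      show "of_int p ^ j * inverse (of_int p) ^ j - 0 * 0 = (1::real)"
        using p_nz by (simp flip: power_mult_distrib)
      show "of_int p ^ j - 1 \<in> multiples (t * p) s" by (rule multiplesI[OF r Zinv_of_int])
      show "0 \<in> multiples (t * p) s" by (rule multiplesI[of _ _ 0]) (auto intro: Zinv_0)
    qed (intro Zinv_closed pinv)+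
    then obtain y where "mat2 (of_int p ^ j) 0 0 (inverse (of_int p) ^ j) ** upper y \<in> H"
      using reduce Zinv_power[OF Zinv_of_int] Zinv_0 by blast
    then show ?thesis using j(1) by (auto simp: mat2_mult)
  qed
  have upper_H: "upper x \<in> H" if x: "x \<in> Zinv (t * p)" for x
  proof -
    obtain k where k: "\<forall>i\<ge>k. of_int p ^ i * x \<in> R" using Zinv_clear[OF p_nz x] by blast
    obtain j y where j: "j \<ge> k" "mat2 (of_int p ^ j) y 0 (inverse (of_int p) ^ j) \<in> H" (is "?g \<in> H")
      using diag by blast
    \<comment> \<open>Conjugation by \<open>?g\<close> scales \<open>x\<close> by the ratio \<open>p^(2 j)\<close> of the diagonal entries.\<close>
    have "of_int p ^ (j + j) * x \<in> R" using k j(1) by simp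
    then have "upper (of_int p ^ (j + j) * x) ** ?g \<in> H"
      using subgroup_mult[OF H _ j(2)] upper_Gam1[OF t_nz] sub(1) by blast
    moreover have "upper (of_int p ^ (j + j) * x) ** ?g = ?g ** upper x"
      using p_nz by (simp add: mat2_mult mat2_eq_iff power_add field_simps)
    ultimately show ?thesis using subgroup_cancel_left[OF H j(2)] by metis
  qed
  fix A assume A: "A \<in> Gam1 (t * p) s"
  obtain a b c d where A': "A = mat2 a b c d" by (rule mat2_cases)
  note a = Gam1D[OF A[unfolded A']]
  obtain k l where k: "\<forall>i\<ge>k. of_int p ^ i * a \<in> R" and l: "\<forall>i\<ge>l. of_int p ^ i * c \<in> R"
    using Zinv_clear[OF p_nz a(1)] Zinv_clear[OF p_nz a(3)] by blast
  obtain j y where j: "j \<ge> k + l" "mat2 (of_int p ^ j) y 0 (inverse (of_int p) ^ j) \<in> H" (is "?g \<in> H")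
    using diag by blast
  define b' d' where "b' = a * y + b * inverse (of_int p) ^ j" and "d' = c * y + d * inverse (of_int p) ^ j"
  have eq: "A ** ?g = mat2 (of_int p ^ j * a) b' (of_int p ^ j * c) d'"
    by (simp add: A' mat2_mult b'_def d'_def mult.commute)
  have "A ** ?g \<in> Gam1 (t * p) s" using Gam1_mult[OF tp_nz A] j(2) sub(2) by blast
  moreover have "of_int p ^ j * a \<in> R" "of_int p ^ j * c \<in> R" using k l j(1) by auto
  ultimately obtain x where x: "x \<in> Zinv (t * p)" "(A ** ?g) ** upper x \<in> H"
    unfolding eq using reduce by blast
  from subgroup_cancel_right[OF H upper_H[OF x(1)] x(2)] have "A ** ?g \<in> H" .
  then show "A \<in> H" using subgroup_cancel_right[OF H j(2)] by blast
qed

end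

section \<open>Division of the parameter by a unit or a prime\<close>

text \<open>Conjugation by \<open>J = diag(1, -1)\<close> is an automorphism of \<open>SL\<^sub>2\<close>, although \<open>J\<close> itself has
  determinant \<open>-1\<close>; it inverts \<open>upper 1\<close> and sends \<open>lower q\<close> to \<open>lower (- q)\<close>. The set \<open>K\<close>
  below is the preimage of \<open>Gam (- q)\<close> under it.\<close>

lemma Gam_minus:
  assumes A: "mat2 a b c d \<in> Gam q"
  shows "mat2 a (- b) (- c) d \<in> Gam (- q)"
proof -
  define J where "J = mat2 1 0 0 (- 1)"
  have J: "J ** mat2 a b c d ** J = mat2 a (- b) (- c) d" for a b c d
    by (simp add: J_def mat2_mult)
  have JJ: "J ** J = mat 1" by (simp add: J_def mat2_mult mat2_one)
  define K where "K = {A \<in> carrier SL2R. J ** A ** J \<in> Gam (- q)}"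
  note G = Gam_subgroup[of "- q"]
  have "subgroup K SL2R"
  proof (rule group.subgroupI[OF group_SL2R])
    show "K \<subseteq> carrier SL2R" by (auto simp: K_def)
    have "mat2 1 0 0 1 \<in> K" using subgroup_one[OF G] by (simp add: K_def J SL2R_def det_mat2)
    then show "K \<noteq> {}" by blast
  next
    fix A assume "A \<in> K"
    then have A: "A \<in> carrier SL2R" "J ** A ** J \<in> Gam (- q)" by (auto simp: K_def)
    let ?B = "inv\<^bsub>SL2R\<^esub> A"
    have B: "?B \<in> carrier SL2R" "?B ** A = mat 1"
      using group.inv_closed[OF group_SL2R A(1)] group.l_inv[OF group_SL2R A(1)]
      by (simp_all add: SL2R_def)
    have "(J ** ?B ** J) ** (J ** A ** J) = J ** (?B ** (J ** J) ** A) ** J"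
      by (simp add: matrix_mul_assoc)
    then have "(J ** ?B ** J) ** (J ** A ** J) = mat 1" by (simp add: JJ B(2))
    then show "?B \<in> K"
      using B(1) subgroup_cancel_right[OF G A(2)] subgroup_one[OF G] by (simp add: K_def mat2_one)
  next
    fix A B assume A: "A \<in> K" and B: "B \<in> K"
    have "(J ** A ** J) ** (J ** B ** J) = J ** (A ** (J ** J) ** B) ** J"
      by (simp add: matrix_mul_assoc)
    then have "J ** (A ** B) ** J = (J ** A ** J) ** (J ** B ** J)" by (simp add: JJ)
    then show "A \<otimes>\<^bsub>SL2R\<^esub> B \<in> K"
      using A B subgroup_mult[OF G] by (simp add: K_def SL2R_def det_mul)
  qed
  moreover have "upper 1 \<in> K"
  proof -
    have "upper 1 ** upper (- 1) = mat2 1 0 0 1" by (simp add: mat2_mult)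
    then have "upper (- 1) \<in> Gam (- q)"
      using subgroup_cancel_left[OF G Gam_generators(1)] subgroup_one[OF G] by metis
    then show ?thesis by (simp add: K_def J SL2R_def det_mat2)
  qed
  moreover have "lower (of_rat q) \<in> K"
    using Gam_generators(2)[of "- q"] by (simp add: K_def J SL2R_def det_mat2 of_rat_minus)
  ultimately have "Gam q \<subseteq> K" by (rule Gam_least)
  then show ?thesis using A J by (auto simp: K_def)
qed

lemma CS_iff:
  assumes "t > 0" "coprime s t"
  shows "of_int s / of_int t \<in> CS \<longleftrightarrow>
    \<bar>of_int s / of_int t :: rat\<bar> < 4 \<and> Gam1 t s \<subseteq> Gam (of_int s / of_int t)"
proof -
  have "quotient_of (of_int s / of_int t) = (s, t)"
    using quotient_of_Fract[of s t] assms by (simp add: Fract_of_int_quotient Rat.normalize_def)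
  then show ?thesis using Gam_subset_Gam1[of t s] assms(1)
    unfolding CS_def abs_less_iff by auto
qed

lemma CS_cases:
  assumes "q \<in> CS"
  obtains s t where "q = of_int s / of_int t" "t > 0" "coprime s t"
    "\<bar>q\<bar> < 4" "Gam1 t s \<subseteq> Gam q"
proof -
  obtain s t where st: "quotient_of q = (s, t)" by fastforce
  show thesis
  proof (rule that)
    show "q = of_int s / of_int t" using quotient_of_div[OF st] .
    show "t > 0" "coprime s t" using quotient_of_denom_pos[OF st] quotient_of_coprime[OF st] by auto
    show "\<bar>q\<bar> < 4" "Gam1 t s \<subseteq> Gam q" using assms st by (auto simp: CS_def)
  qed
qed

lemma CS_uminus:
  assumes "q \<in> CS" shows "- q \<in> CS"
proof -
  obtain s t where st: "q = of_int s / of_int t" "t > 0" "coprime s t" "\<bar>q\<bar> < 4" "Gam1 t s \<subseteq> Gam q"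
    using CS_cases[OF assms] .
  have "Gam1 t (- s) \<subseteq> Gam (- q)"
  proof
    fix A assume A: "A \<in> Gam1 t (- s)"
    obtain a b c d where A': "A = mat2 a b c d" by (rule mat2_cases)
    have neg: "x \<in> multiples t s" if "x \<in> multiples t (- s)" for x
    proof -
      from that obtain y where "y \<in> Zinv t" "x = of_int (- s) * y" by blast
      then show ?thesis by (intro multiplesI[of _ s "- y"] Zinv_minus) simp_all
    qed
    note a = Gam1D[OF A[unfolded A']]
    have "mat2 a (- b) (- c) d \<in> Gam1 t s"
    proof (rule Gam1I)
      show "a * d - - b * - c = 1" "t \<noteq> 0" using a(5) st(2) by simp_all
    qed (intro Zinv_minus multiples_minus neg a)+
    then show "A \<in> Gam (- q)" using Gam_minus[of a "- b" "- c" d q] st(5) A' by auto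
  qed
  then show ?thesis using CS_iff[of t "- s"] st by simp
qed

text \<open>The case distinction follows the lowest terms of \<open>q/p\<close>: these are \<open>(s/p)/t\<close> if \<open>p\<close> divides
  \<open>s\<close>, and \<open>s/(t p)\<close> otherwise.\<close>

lemma CS_divide_prime:
  fixes p :: int
  assumes q: "q \<in> CS" and p: "prime p"
  shows "q / of_int p \<in> CS"
proof -
  obtain s t where st: "q = of_int s / of_int t" "t > 0" "coprime s t" "\<bar>q\<bar> < 4" "Gam1 t s \<subseteq> Gam q"
    using CS_cases[OF q] .
  have p1: "p \<ge> 1" and p0: "p \<noteq> 0" "p > 0" using prime_ge_1_int[OF p] by auto
  let ?r = "q / of_int p" and ?H = "Gam (q / of_int p)"
  note H = Gam_subgroup[of ?r] and gen = Gam_generators[of ?r]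
  have "lower (of_int p * of_rat ?r) \<in> ?H" by (rule lower_multiple[OF H gen(2)])
  then have "lower (of_rat q) \<in> ?H" using p0 by (simp add: of_rat_divide)
  then have "Gam q \<subseteq> ?H" by (rule Gam_least[OF H gen(1)])
  then have sub: "Gam1 t s \<subseteq> ?H" using st(5) by blast
  have "\<bar>?r\<bar> \<le> \<bar>q\<bar>" using p1 by (simp add: abs_divide divide_le_eq mult_le_cancel_left1)
  then have small: "\<bar>?r\<bar> < 4" using st(4) by linarith
  show ?thesis
  proof (cases "p dvd s")
    case True
    then obtain s' where s': "s = p * s'" by auto
    then have cop: "coprime s' t" using st(3) by simp
    have "\<not> p dvd t" using st(3) s' p by (metis coprime_common_divisor dvd_triv_left not_prime_unit)
    then interpret prime_away t p using st(2) p by unfold_locales auto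
    have r: "?r = of_int s' / of_int t" using p0 by (simp add: st(1) s')
    have "Gam1 t s' \<subseteq> ?H"
      using level_division[OF H sub[unfolded s']] gen(2) by (simp add: r of_rat_divide)
    then show ?thesis using CS_iff[OF st(2) cop] small by (simp add: r)
  next
    case ps: False
    have cop: "coprime s (t * p)"
      using st(3) prime_imp_coprime[OF p ps] by (simp add: coprime_commute)
    have r: "?r = of_int s / of_int (t * p)" by (simp add: st(1))
    have tp: "t * p > 0" using st(2) p0 by simp
    have "Gam1 (t * p) s \<subseteq> ?H"
    proof (cases "p dvd t")
      case True
      then have "Gam1 (t * p) s = Gam1 t s" using Zinv_absorb[of t p] st(2) by (simp add: Gam1_def)
      then show ?thesis using sub by simp
    next
      case False
      then interpret prime_away t p using st(2) p by unfold_locales auto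
      show ?thesis
      proof (rule prime_inversion[OF H ps sub])
        show "?H \<subseteq> Gam1 (t * p) s" unfolding r by (rule Gam_subset_Gam1[OF tp_nz])
        show "lower (of_int s / (of_int t * of_int p)) \<in> ?H"
          using gen(2) by (simp add: r of_rat_divide of_rat_mult)
      qed
    qed
    then show ?thesis using CS_iff[OF tp cop] small by (simp add: r)
  qed
qed

theorem corollary1p3:
  fixes q :: rat and n :: int
  assumes "q \<in> CS" and "n \<noteq> 0"
  shows "q / of_int n \<in> CS"
  using assms
proof (induction n arbitrary: q rule: prime_divisors_induct)
  case zero
  then show ?case by simp
next
  case (unit n)
  then have "n = 1 \<or> n = - 1" by auto
  then show ?case using unit CS_uminus by auto
next
  case (factor p n)
  have "q / of_int p / of_int n \<in> CS"
    using factor.prems by (intro factor.IH CS_divide_prime factor.hyps) auto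
  then show ?case by (simp add: divide_divide_eq_left)
qed

end
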